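(* Let $S$ be a pomonoid and let $f:A_S\to B_S$ be an $S$-poset map between right $S$-posets that is an Emb-injective object in the slice category $\mathbf{Pos}\text{-}S/B_S$. Then: (i) $\mathbf{Pos}_S(B_S,A_S)$ is a generator in $\mathbf{Pos}\text{-}\mathrm{End}(B_S)$; (ii) $\mathbf{Pos}_S(A_S,B_S)$ is a generator in $\mathrm{End}(B_S)\text{-}\mathbf{Pos}$; (iii) $\mathbf{Pos}_S(B_S,A_S)$ is a cyclic projective in $\mathrm{End}(A_S)\text{-}\mathbf{Pos}$; (iv) $\mathbf{Pos}_S(A_S,B_S)$ is a cyclic projective in $\mathbf{Pos}\text{-}\mathrm{End}(A_S)$.
   Context: A pomonoid is a monoid $S$ with a partial order $\leq$ such that $s\leq t$ and $s'\leq t'$ imply $ss'\leq tt'$. A (right) $S$-poset is a poset $A$ with a right monoid action $A\times S\to A$ that is order-preserving for the componentwise order on $A\times S$. $\mathbf{Pos}\text{-}S$ is the category of right $S$-posets with monotone action-preserving maps ($S$-poset maps); for a pomonoid $T$, $\mathbf{Pos}\text{-}T$ and $T\text{-}\mathbf{Pos}$ are the categories of right and left $T$-posets. An object $G$ of such a category is a generator if for any two distinct morphisms $\alpha,\beta:X\to Y$ there is a morphism $g:G\to X$ with $\alpha g\neq\beta g$. Projective means projective with respect to epimorphisms, which are exactly the surjective morphisms; a right (left) $T$-poset $C$ is cyclic if $C=cT$ ($C=Tc$) for some $c\in C$; cyclic projective means cyclic and projective. $\mathbf{Pos}_S(X,Y)$ is the set of $S$-poset maps $X\to Y$ with pointwise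 order, and $\mathrm{End}(X)=\mathbf{Pos}_S(X,X)$ is a pomonoid under composition. $\mathbf{Pos}_S(X,Y)$ is a left $\mathrm{End}(Y)$-poset via $t\cdot g=t\circ g$ and a right $\mathrm{End}(X)$-poset via $g\cdot t=g\circ t$. Objects of $\mathbf{Pos}\text{-}S/B_S$ are $S$-poset maps with codomain $B_S$; morphisms from $p:D\to B_S$ to $q:E\to B_S$ are $S$-poset maps $h:D\to E$ with $qh=p$. Emb is the class of order-embeddings ($S$-poset maps $h$ with $h(x)\leq h(y)\iff x\leq y$). An object $f:A_S\to B_S$ is Emb-injective in $\mathbf{Pos}\text{-}S/B_S$ if for every order-embedding $h:U\to V$ of $S$-posets and $S$-poset maps $u:U\to A_S$, $v:V\to B_S$ with $fu=vh$, there is an $S$-poset map $s:V\to A_S$ with $sh=u$ and $fs=v$. *)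

theory Defs
  imports "HOL-Algebra.Group" "HOL-Library.FuncSet"
begin

record 's pomonoid = "'s monoid" +
  mord :: "'s rel"

locale pomonoid = monoid S for S :: "('s, 'm) pomonoid_scheme" (structure) +
  assumes partial_order: "partial_order_on (carrier S) (mord S)"
    and mult_mono:
      "\<lbrakk>(s, t) \<in> mord S; (s', t') \<in> mord S\<rbrakk> \<Longrightarrow> (s \<otimes> s', t \<otimes> t') \<in> mord S"

text \<open>
  Left and right \<open>S\<close>-posets share one record type; \<open>act A s x\<close> stands for \<open>s x\<close> in a left
  \<open>S\<close>-poset and for \<open>x s\<close> in a right one. The side only enters through the associativity law.
  Carriers may be empty.
\<close>

record ('s, 'a) sposet = "'a partial_object" +
  ord :: "'a rel"
  act :: "'s \<Rightarrow> 'a \<Rightarrow> 'a"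

locale sposet_base = pomonoid S
  for S :: "('s, 'm) pomonoid_scheme" (structure) and A :: "('s, 'a, 'n) sposet_scheme" +
  assumes ord_partial_order: "partial_order_on (carrier A) (ord A)"
    and act_closed: "\<lbrakk>s \<in> carrier S; x \<in> carrier A\<rbrakk> \<Longrightarrow> act A s x \<in> carrier A"
    and act_one: "x \<in> carrier A \<Longrightarrow> act A \<one> x = x"
    and act_mono:
      "\<lbrakk>(x, y) \<in> ord A; (s, t) \<in> mord S\<rbrakk> \<Longrightarrow> (act A s x, act A t y) \<in> ord A"

locale right_sposet = sposet_base +
  assumes act_mult: "\<lbrakk>s \<in> carrier S; t \<in> carrier S; x \<in> carrier A\<rbrakk>
      \<Longrightarrow> act A (s \<otimes> t) x = act A t (act A s x)"

locale left_sposet = sposet_base +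
  assumes act_mult: "\<lbrakk>s \<in> carrier S; t \<in> carrier S; x \<in> carrier A\<rbrakk>
      \<Longrightarrow> act A (s \<otimes> t) x = act A s (act A t x)"

text \<open>
  Maps are extensional (\<open>undefined\<close> off the carrier), so that equality of morphisms is equality
  of HOL functions and the pointwise order on a hom-set is antisymmetric.
\<close>

definition sposet_hom ::
  "('s, 'm) pomonoid_scheme \<Rightarrow> ('s, 'a, 'n) sposet_scheme \<Rightarrow> ('s, 'b, 'k) sposet_scheme
    \<Rightarrow> ('a \<Rightarrow> 'b) set" where
  "sposet_hom S X Y = {f \<in> carrier X \<rightarrow>\<^sub>E carrier Y.
     (\<forall>x y. (x, y) \<in> ord X \<longrightarrow> (f x, f y) \<in> ord Y) \<and>
     (\<forall>s\<in>carrier S. \<forall>x\<in>carrier X. f (act X s x) = act Y s (f x))}"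

definition sposet_embedding ::
  "('s, 'm) pomonoid_scheme \<Rightarrow> ('s, 'a, 'n) sposet_scheme \<Rightarrow> ('s, 'b, 'k) sposet_scheme
    \<Rightarrow> ('a \<Rightarrow> 'b) \<Rightarrow> bool" where
  "sposet_embedding S X Y h \<longleftrightarrow> h \<in> sposet_hom S X Y \<and>
     (\<forall>x\<in>carrier X. \<forall>y\<in>carrier X. (h x, h y) \<in> ord Y \<longleftrightarrow> (x, y) \<in> ord X)"

definition hom_ord ::
  "('s, 'm) pomonoid_scheme \<Rightarrow> ('s, 'a, 'n) sposet_scheme \<Rightarrow> ('s, 'b, 'k) sposet_scheme
    \<Rightarrow> ('a \<Rightarrow> 'b) rel" where
  "hom_ord S X Y = {(g, h). g \<in> sposet_hom S X Y \<and> h \<in> sposet_hom S X Y \<and>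
     (\<forall>x\<in>carrier X. (g x, h x) \<in> ord Y)}"

definition End_pomonoid ::
  "('s, 'm) pomonoid_scheme \<Rightarrow> ('s, 'a, 'n) sposet_scheme \<Rightarrow> ('a \<Rightarrow> 'a) pomonoid" where
  "End_pomonoid S X =
     \<lparr>carrier = sposet_hom S X X, mult = (\<lambda>g h. compose (carrier X) g h),
      one = (\<lambda>x\<in>carrier X. x), mord = hom_ord S X X\<rparr>"

text \<open>
  \<open>Pos\<^sub>S(X,Y)\<close> as a left \<open>End(Y)\<close>-poset, \<open>t \<cdot> g = t \<circ> g\<close>, and as a right \<open>End(X)\<close>-poset,
  \<open>g \<cdot> t = g \<circ> t\<close>.
\<close>

definition hom_left ::
  "('s, 'm) pomonoid_scheme \<Rightarrow> ('s, 'a, 'n) sposet_scheme \<Rightarrow> ('s, 'b, 'k) sposet_scheme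
    \<Rightarrow> ('b \<Rightarrow> 'b, 'a \<Rightarrow> 'b) sposet" where
  "hom_left S X Y = \<lparr>carrier = sposet_hom S X Y, ord = hom_ord S X Y,
      act = (\<lambda>t g. compose (carrier X) t g)\<rparr>"

definition hom_right ::
  "('s, 'm) pomonoid_scheme \<Rightarrow> ('s, 'a, 'n) sposet_scheme \<Rightarrow> ('s, 'b, 'k) sposet_scheme
    \<Rightarrow> ('a \<Rightarrow> 'a, 'a \<Rightarrow> 'b) sposet" where
  "hom_right S X Y = \<lparr>carrier = sposet_hom S X Y, ord = hom_ord S X Y,
      act = (\<lambda>t g. compose (carrier X) g t)\<rparr>"

text \<open>
  Generators and projectives are tested against objects with carriers in arbitrary types \<open>'x\<close>
  and \<open>'y\<close>, which HOL requires to be explicit parameters of the definitions.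
\<close>

definition right_generator ::
  "'x itself \<Rightarrow> 'y itself \<Rightarrow> 't pomonoid \<Rightarrow> ('t, 'g) sposet \<Rightarrow> bool" where
  "right_generator _ _ T G \<longleftrightarrow> right_sposet T G \<and>
     (\<forall>(X :: ('t, 'x) sposet) (Y :: ('t, 'y) sposet). right_sposet T X \<longrightarrow> right_sposet T Y \<longrightarrow>
       (\<forall>\<alpha>\<in>sposet_hom T X Y. \<forall>\<beta>\<in>sposet_hom T X Y. \<alpha> \<noteq> \<beta> \<longrightarrow>
         (\<exists>g\<in>sposet_hom T G X. compose (carrier G) \<alpha> g \<noteq> compose (carrier G) \<beta> g)))"

definition left_generator ::
  "'x itself \<Rightarrow> 'y itself \<Rightarrow> 't pomonoid \<Rightarrow> ('t, 'g) sposet \<Rightarrow> bool" where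
  "left_generator _ _ T G \<longleftrightarrow> left_sposet T G \<and>
     (\<forall>(X :: ('t, 'x) sposet) (Y :: ('t, 'y) sposet). left_sposet T X \<longrightarrow> left_sposet T Y \<longrightarrow>
       (\<forall>\<alpha>\<in>sposet_hom T X Y. \<forall>\<beta>\<in>sposet_hom T X Y. \<alpha> \<noteq> \<beta> \<longrightarrow>
         (\<exists>g\<in>sposet_hom T G X. compose (carrier G) \<alpha> g \<noteq> compose (carrier G) \<beta> g)))"

text \<open>Epimorphisms of \<open>T\<close>-posets are exactly the surjective morphisms.\<close>

definition sposet_epi ::
  "('s, 'm) pomonoid_scheme \<Rightarrow> ('s, 'a, 'n) sposet_scheme \<Rightarrow> ('s, 'b, 'k) sposet_scheme
    \<Rightarrow> ('a \<Rightarrow> 'b) \<Rightarrow> bool" where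
  "sposet_epi S X Y e \<longleftrightarrow> e \<in> sposet_hom S X Y \<and> e ` carrier X = carrier Y"

definition right_projective ::
  "'x itself \<Rightarrow> 'y itself \<Rightarrow> 't pomonoid \<Rightarrow> ('t, 'c) sposet \<Rightarrow> bool" where
  "right_projective _ _ T C \<longleftrightarrow> right_sposet T C \<and>
     (\<forall>(X :: ('t, 'x) sposet) (Y :: ('t, 'y) sposet) e. right_sposet T X \<longrightarrow> right_sposet T Y \<longrightarrow>
       sposet_epi T X Y e \<longrightarrow>
       (\<forall>k\<in>sposet_hom T C Y. \<exists>l\<in>sposet_hom T C X. compose (carrier C) e l = k))"

definition left_projective ::
  "'x itself \<Rightarrow> 'y itself \<Rightarrow> 't pomonoid \<Rightarrow> ('t, 'c) sposet \<Rightarrow> bool" where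
  "left_projective _ _ T C \<longleftrightarrow> left_sposet T C \<and>
     (\<forall>(X :: ('t, 'x) sposet) (Y :: ('t, 'y) sposet) e. left_sposet T X \<longrightarrow> left_sposet T Y \<longrightarrow>
       sposet_epi T X Y e \<longrightarrow>
       (\<forall>k\<in>sposet_hom T C Y. \<exists>l\<in>sposet_hom T C X. compose (carrier C) e l = k))"

definition cyclic_sposet :: "'t pomonoid \<Rightarrow> ('t, 'c) sposet \<Rightarrow> bool" where
  "cyclic_sposet T C \<longleftrightarrow> (\<exists>c\<in>carrier C. carrier C = (\<lambda>t. act C t c) ` carrier T)"

definition right_cyclic_projective ::
  "'x itself \<Rightarrow> 'y itself \<Rightarrow> 't pomonoid \<Rightarrow> ('t, 'c) sposet \<Rightarrow> bool" where
  "right_cyclic_projective X Y T C \<longleftrightarrow> cyclic_sposet T C \<and> right_projective X Y T C"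

definition left_cyclic_projective ::
  "'x itself \<Rightarrow> 'y itself \<Rightarrow> 't pomonoid \<Rightarrow> ('t, 'c) sposet \<Rightarrow> bool" where
  "left_cyclic_projective X Y T C \<longleftrightarrow> cyclic_sposet T C \<and> left_projective X Y T C"

text \<open>
  All objects of \<open>Pos-S\<close> occurring here, the test objects \<open>U\<close> and \<open>V\<close> included, have their
  carriers in one type \<open>'u\<close>, which plays the role of the universe over which \<open>Pos-S\<close> is formed.
  Like any such universe it has to be infinite to be meaningful (a finite type is not closed
  under coproducts); this is left to the statements that use the definition.
\<close>

definition Emb_injective_over ::
  "'s pomonoid \<Rightarrow> ('s, 'u) sposet \<Rightarrow> ('s, 'u) sposet \<Rightarrow> ('u \<Rightarrow> 'u) \<Rightarrow> bool" where
  "Emb_injective_over S A B f \<longleftrightarrow>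
     (\<forall>(U :: ('s, 'u) sposet) (V :: ('s, 'u) sposet) h u v.
       right_sposet S U \<longrightarrow> right_sposet S V \<longrightarrow> sposet_embedding S U V h \<longrightarrow>
       u \<in> sposet_hom S U A \<longrightarrow> v \<in> sposet_hom S V B \<longrightarrow>
       compose (carrier U) f u = compose (carrier U) v h \<longrightarrow>
       (\<exists>s\<in>sposet_hom S V A. compose (carrier U) s h = u \<and> compose (carrier V) f s = v))"

end

theory Submission
  imports Defs
begin

text \<open>
  Since carriers may be empty, the embedding of the empty \<open>S\<close>-poset into \<open>B\<close> is a legitimate test
  map for Emb-injectivity, and it shows that \<open>f\<close> has a section \<open>g\<close>. Composition with \<open>f\<close> and
  with \<open>g\<close> then maps the hom-posets to the regular \<open>End(B)\<close>- and \<open>End(A)\<close>-posets. Over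
  \<open>End(B)\<close> the unit \<open>f g\<close> is attained, so the regular poset, which is a generator, is a quotient
  of the hom-poset. Over \<open>End(A)\<close> the map has a one-sided inverse given by acting on \<open>g\<close> or on
  \<open>f\<close>, so the hom-poset is a retract of the regular poset, which is cyclic projective.
\<close>

section \<open>Morphisms of \<open>S\<close>-posets and elementary order facts\<close>

lemma sposet_homI:
  assumes "h \<in> carrier X \<rightarrow>\<^sub>E carrier Y"
    and "\<And>x y. (x, y) \<in> ord X \<Longrightarrow> (h x, h y) \<in> ord Y"
    and "\<And>s x. \<lbrakk>s \<in> carrier S; x \<in> carrier X\<rbrakk> \<Longrightarrow> h (act X s x) = act Y s (h x)"
  shows "h \<in> sposet_hom S X Y"
  using assms by (simp add: sposet_hom_def)

lemma sposet_homD: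
  assumes "h \<in> sposet_hom S X Y"
  shows sposet_hom_PiE: "h \<in> carrier X \<rightarrow>\<^sub>E carrier Y"
    and sposet_hom_closed: "x \<in> carrier X \<Longrightarrow> h x \<in> carrier Y"
    and sposet_hom_mono: "(x, y) \<in> ord X \<Longrightarrow> (h x, h y) \<in> ord Y"
    and sposet_hom_act: "\<lbrakk>s \<in> carrier S; x \<in> carrier X\<rbrakk> \<Longrightarrow> h (act X s x) = act Y s (h x)"
  using assms by (auto simp: sposet_hom_def)

lemma sposet_hom_ext:
  assumes "h \<in> sposet_hom S X Y" "k \<in> sposet_hom S X Y"
    and "\<And>x. x \<in> carrier X \<Longrightarrow> h x = k x"
  shows "h = k"
  using assms by (metis PiE_ext sposet_hom_PiE)

context sposet_base
begin

lemma ord_carrier: "(x, y) \<in> ord A \<Longrightarrow> x \<in> carrier A \<and> y \<in> carrier A"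
  using ord_partial_order by (auto simp: order_on_defs)

lemma ord_refl: "x \<in> carrier A \<Longrightarrow> (x, x) \<in> ord A"
  using ord_partial_order by (auto simp: order_on_defs refl_on_def)

lemma ord_trans: "\<lbrakk>(x, y) \<in> ord A; (y, z) \<in> ord A\<rbrakk> \<Longrightarrow> (x, z) \<in> ord A"
  using ord_partial_order by (auto simp: order_on_defs elim: transE)

lemma ord_antisym: "\<lbrakk>(x, y) \<in> ord A; (y, x) \<in> ord A\<rbrakk> \<Longrightarrow> x = y"
  using ord_partial_order by (auto simp: order_on_defs elim: antisymD)

end

section \<open>Identities and composition\<close>

lemma sposet_hom_id:
  assumes "sposet_base S X"
  shows "(\<lambda>x\<in>carrier X. x) \<in> sposet_hom S X X"
  using sposet_base.ord_carrier[OF assms] sposet_base.act_closed[OF assms]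
  by (intro sposet_homI) auto

lemma sposet_hom_compose:
  assumes X: "sposet_base S X" and h: "h \<in> sposet_hom S X Y" and k: "k \<in> sposet_hom S Y Z"
  shows "compose (carrier X) k h \<in> sposet_hom S X Z"
proof (rule sposet_homI)
  show "compose (carrier X) k h \<in> carrier X \<rightarrow>\<^sub>E carrier Z"
    using sposet_hom_closed[OF h] sposet_hom_closed[OF k] by (auto simp: compose_def)
  show "(compose (carrier X) k h x, compose (carrier X) k h y) \<in> ord Z" if "(x, y) \<in> ord X" for x y
    using that sposet_base.ord_carrier[OF X that] sposet_hom_mono[OF h] sposet_hom_mono[OF k]
    by (simp add: compose_eq)
  show "compose (carrier X) k h (act X s x) = act Z s (compose (carrier X) k h x)"
    if "s \<in> carrier S" "x \<in> carrier X" for s x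
    using that sposet_base.act_closed[OF X] sposet_hom_closed[OF h]
    by (simp add: compose_eq sposet_hom_act[OF h] sposet_hom_act[OF k])
qed

lemma sposet_hom_compose_assoc:
  assumes "h \<in> sposet_hom S X Y"
  shows "compose (carrier X) l (compose (carrier X) k h)
    = compose (carrier X) (compose (carrier Y) l k) h"
  using sposet_hom_closed[OF assms] by (intro compose_assoc) auto

lemma sposet_hom_compose_id:
  assumes "h \<in> sposet_hom S X Y"
  shows "compose (carrier X) h (\<lambda>x\<in>carrier X. x) = h"
    and "compose (carrier X) (\<lambda>y\<in>carrier Y. y) h = h"
  using sposet_hom_PiE[OF assms] by (auto simp: PiE_iff intro: compose_Id Id_compose)

section \<open>Hom-sets as posets over endomorphism pomonoids\<close>

lemma partial_order_hom_ord:
  assumes "sposet_base S Y"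
  shows "partial_order_on (sposet_hom S X Y) (hom_ord S X Y)"
proof -
  interpret Y: sposet_base S Y by fact
  have "refl_on (sposet_hom S X Y) (hom_ord S X Y)"
    by (auto simp: hom_ord_def refl_on_def intro: Y.ord_refl dest: sposet_hom_closed)
  moreover have "trans (hom_ord S X Y)"
    by (rule transI) (auto simp: hom_ord_def intro: Y.ord_trans)
  \<comment> \<open>Antisymmetry in \<open>Y\<close> only gives agreement on
    \<open>carrier X\<close>; extensionality of morphisms turns this into equality of
    functions.\<close>
  moreover have "antisym (hom_ord S X Y)"
    by (rule antisymI) (auto simp: hom_ord_def intro: sposet_hom_ext Y.ord_antisym)
  ultimately show ?thesis
    by (auto simp: order_on_defs hom_ord_def)
qed

text \<open>Monotonicity in both factors at once yields compatibility of multiplication in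
  \<open>End_pomonoid\<close> with its order, and monotonicity of the actions on
  \<open>hom_left\<close> and \<open>hom_right\<close>.\<close>

lemma hom_ord_compose:
  assumes X: "sposet_base S X" and Z: "sposet_base S Z"
    and h: "(h, h') \<in> hom_ord S X Y" and k: "(k, k') \<in> hom_ord S Y Z"
  shows "(compose (carrier X) k h, compose (carrier X) k' h') \<in> hom_ord S X Z"
proof -
  have "(k (h x), k' (h' x)) \<in> ord Z" if "x \<in> carrier X" for x
  \<comment> \<open>The middle term is \<open>k (h' x)\<close>: monotonicity of \<open>k\<close>
    gives the first inequality, and the comparison of \<open>k\<close> with \<open>k'\<close> at
    \<open>h' x\<close> the second.\<close>
  proof (rule sposet_base.ord_trans[OF Z])
    show "(k (h x), k (h' x)) \<in> ord Z" "(k (h' x), k' (h' x)) \<in> ord Z"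
      using that h k by (auto simp: hom_ord_def dest: sposet_hom_mono sposet_hom_closed)
  qed
  then show ?thesis
    using h k by (auto simp: hom_ord_def compose_eq intro: sposet_hom_compose[OF X])
qed

lemma pomonoid_End:
  assumes X: "sposet_base S X"
  shows "pomonoid (End_pomonoid S X)"
proof (intro pomonoid.intro monoidI pomonoid_axioms.intro)
  show "partial_order_on (carrier (End_pomonoid S X)) (mord (End_pomonoid S X))"
    using partial_order_hom_ord[OF X] by (simp add: End_pomonoid_def)
qed (auto simp: End_pomonoid_def sposet_hom_compose_id sposet_hom_compose_assoc
      intro: sposet_hom_id[OF X] sposet_hom_compose[OF X] hom_ord_compose[OF X X])

lemma right_sposet_hom_right:
  assumes X: "sposet_base S X" and Y: "sposet_base S Y"
  shows "right_sposet (End_pomonoid S X) (hom_right S X Y)"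
proof (intro right_sposet.intro sposet_base.intro sposet_base_axioms.intro
    right_sposet_axioms.intro pomonoid_End[OF X])
  show "partial_order_on (carrier (hom_right S X Y)) (ord (hom_right S X Y))"
    using partial_order_hom_ord[OF Y] by (simp add: hom_right_def)
qed (auto simp: End_pomonoid_def hom_right_def sposet_hom_compose_id sposet_hom_compose_assoc
      intro: sposet_hom_compose[OF X] hom_ord_compose[OF X Y])

lemma left_sposet_hom_left:
  assumes X: "sposet_base S X" and Y: "sposet_base S Y"
  shows "left_sposet (End_pomonoid S Y) (hom_left S X Y)"
proof (intro left_sposet.intro sposet_base.intro sposet_base_axioms.intro
    left_sposet_axioms.intro pomonoid_End[OF Y])
  show "partial_order_on (carrier (hom_left S X Y)) (ord (hom_left S X Y))"
    using partial_order_hom_ord[OF Y] by (simp add: hom_left_def)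
qed (auto simp: End_pomonoid_def hom_left_def sposet_hom_compose_id sposet_hom_compose_assoc
      intro: sposet_hom_compose[OF X] hom_ord_compose[OF X Y])

text \<open>The action precomposes while \<open>k\<close> postcomposes, so equivariance is
  associativity: \<open>k (h t) = (k h) t\<close>. For \<open>Z = X\<close> the target is the
  regular poset of \<open>End(X)\<close>.\<close>

lemma hom_right_compose:
  assumes X: "sposet_base S X" and Z: "sposet_base S Z" and k: "k \<in> sposet_hom S Y Z"
  shows "(\<lambda>h\<in>sposet_hom S X Y. compose (carrier X) k h)
    \<in> sposet_hom (End_pomonoid S X) (hom_right S X Y) (hom_right S X Z)"
proof -
  \<comment> \<open>Reflexivity at \<open>k\<close> makes \<open>hom_ord_compose\<close> applicable
    with one factor held fixed.\<close>
  have "(k, k) \<in> hom_ord S Y Z"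
    using k partial_order_hom_ord[OF Z] by (auto simp: order_on_defs refl_on_def)
  moreover have "h \<in> sposet_hom S X Y \<and> h' \<in> sposet_hom S X Y" if "(h, h') \<in> hom_ord S X Y" for h h'
    using that by (simp add: hom_ord_def)
  ultimately show ?thesis
    using k
    by (intro sposet_homI)
      (auto simp: hom_right_def End_pomonoid_def sposet_hom_compose_assoc
        intro: sposet_hom_compose[OF X] hom_ord_compose[OF X Z])
qed

text \<open>Dual situation: here \<open>k\<close> precomposes and the action postcomposes, so
  associativity again gives equivariance. For \<open>W = Y\<close> the target is the regular poset
  of \<open>End(Y)\<close>.\<close>

lemma hom_left_compose:
  assumes W: "sposet_base S W" and X: "sposet_base S X" and Y: "sposet_base S Y"
    and k: "k \<in> sposet_hom S W X"
  shows "(\<lambda>h\<in>sposet_hom S X Y. compose (carrier W) h k)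
    \<in> sposet_hom (End_pomonoid S Y) (hom_left S X Y) (hom_left S W Y)"
proof -
  have "(k, k) \<in> hom_ord S W X"
    using k partial_order_hom_ord[OF X] by (auto simp: order_on_defs refl_on_def)
  moreover have "h \<in> sposet_hom S X Y \<and> h' \<in> sposet_hom S X Y" if "(h, h') \<in> hom_ord S X Y" for h h'
    using that by (simp add: hom_ord_def)
  ultimately show ?thesis
    using k
    by (intro sposet_homI)
      (auto simp: hom_left_def End_pomonoid_def sposet_hom_compose_assoc
        intro: sposet_hom_compose[OF W] sposet_hom_compose[OF X] hom_ord_compose[OF W Y])
qed

section \<open>Regular posets and orbit maps\<close>

definition right_regular :: "'t pomonoid \<Rightarrow> ('t, 't) sposet" where
  "right_regular T = \<lparr>carrier = carrier T, ord = mord T, act = (\<lambda>t x. x \<otimes>\<^bsub>T\<^esub> t)\<rparr>"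

definition left_regular :: "'t pomonoid \<Rightarrow> ('t, 't) sposet" where
  "left_regular T = \<lparr>carrier = carrier T, ord = mord T, act = (\<lambda>t x. t \<otimes>\<^bsub>T\<^esub> x)\<rparr>"

text \<open>Used in folded form, to read composition with a fixed morphism as a map into the regular
  poset.\<close>

lemma regular_End:
  shows "right_regular (End_pomonoid S X) = hom_right S X X"
    and "left_regular (End_pomonoid S X) = hom_left S X X"
  by (simp_all add: right_regular_def left_regular_def End_pomonoid_def hom_right_def hom_left_def)

lemma right_orbit_hom:
  assumes G: "right_sposet T G" and X: "right_sposet T X" and x: "x \<in> carrier X"
    and q: "q \<in> sposet_hom T G (right_regular T)"
  shows "(\<lambda>c\<in>carrier G. act X (q c) x) \<in> sposet_hom T G X"
proof -
  interpret G: right_sposet T G by fact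
  interpret X: right_sposet T X by fact
  show ?thesis
    using sposet_homD[OF q]
    by (intro sposet_homI) (auto simp: right_regular_def x X.act_mult
        intro!: X.act_closed X.act_mono X.ord_refl G.act_closed dest: G.ord_carrier)
qed

lemma left_orbit_hom:
  assumes G: "left_sposet T G" and X: "left_sposet T X" and x: "x \<in> carrier X"
    and q: "q \<in> sposet_hom T G (left_regular T)"
  shows "(\<lambda>c\<in>carrier G. act X (q c) x) \<in> sposet_hom T G X"
proof -
  interpret G: left_sposet T G by fact
  interpret X: left_sposet T X by fact
  show ?thesis
    using sposet_homD[OF q]
    by (intro sposet_homI) (auto simp: left_regular_def x X.act_mult
        intro!: X.act_closed X.act_mono X.ord_refl G.act_closed dest: G.ord_carrier)
qed

lemma right_generatorI:
  fixes T :: "'t pomonoid"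
  assumes G: "right_sposet T G" and q: "q \<in> sposet_hom T G (right_regular T)"
    and c: "c \<in> carrier G" "q c = \<one>\<^bsub>T\<^esub>"
  shows "right_generator TYPE('x) TYPE('y) T G"
  unfolding right_generator_def
proof (intro conjI G allI impI ballI)
  fix X :: "('t, 'x) sposet" and Y :: "('t, 'y) sposet" and \<alpha> \<beta>
  assume X: "right_sposet T X" and hom: "\<alpha> \<in> sposet_hom T X Y" "\<beta> \<in> sposet_hom T X Y"
    and "\<alpha> \<noteq> \<beta>"
  then obtain x where x: "x \<in> carrier X" "\<alpha> x \<noteq> \<beta> x"
    using sposet_hom_ext[OF hom] by blast
  interpret X: right_sposet T X by fact
  show "\<exists>g\<in>sposet_hom T G X. compose (carrier G) \<alpha> g \<noteq> compose (carrier G) \<beta> g"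
  proof (intro bexI notI)
    let ?g = "\<lambda>d\<in>carrier G. act X (q d) x"
    show "?g \<in> sposet_hom T G X"
      by (rule right_orbit_hom[OF G X x(1) q])
    assume "compose (carrier G) \<alpha> ?g = compose (carrier G) \<beta> ?g"
    from fun_cong[OF this, of c] show False
      using c x by (simp add: compose_eq X.act_one)
  qed
qed

lemma left_generatorI:
  fixes T :: "'t pomonoid"
  assumes G: "left_sposet T G" and q: "q \<in> sposet_hom T G (left_regular T)"
    and c: "c \<in> carrier G" "q c = \<one>\<^bsub>T\<^esub>"
  shows "left_generator TYPE('x) TYPE('y) T G"
  unfolding left_generator_def
proof (intro conjI G allI impI ballI)
  fix X :: "('t, 'x) sposet" and Y :: "('t, 'y) sposet" and \<alpha> \<beta>
  assume X: "left_sposet T X" and hom: "\<alpha> \<in> sposet_hom T X Y" "\<beta> \<in> sposet_hom T X Y"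
    and "\<alpha> \<noteq> \<beta>"
  then obtain x where x: "x \<in> carrier X" "\<alpha> x \<noteq> \<beta> x"
    using sposet_hom_ext[OF hom] by blast
  interpret X: left_sposet T X by fact
  show "\<exists>g\<in>sposet_hom T G X. compose (carrier G) \<alpha> g \<noteq> compose (carrier G) \<beta> g"
  proof (intro bexI notI)
    let ?g = "\<lambda>d\<in>carrier G. act X (q d) x"
    show "?g \<in> sposet_hom T G X"
      by (rule left_orbit_hom[OF G X x(1) q])
    assume "compose (carrier G) \<alpha> ?g = compose (carrier G) \<beta> ?g"
    from fun_cong[OF this, of c] show False
      using c x by (simp add: compose_eq X.act_one)
  qed
qed

lemma cyclic_sposetI:
  assumes "sposet_base T C" and "c \<in> carrier C"
    and "\<And>x. x \<in> carrier C \<Longrightarrow> q x \<in> carrier T \<and> act C (q x) c = x"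
  shows "cyclic_sposet T C"
  unfolding cyclic_sposet_def
proof (intro bexI equalityI subsetI)
  show "x \<in> (\<lambda>t. act C t c) ` carrier T" if "x \<in> carrier C" for x
    using assms(3)[OF that] by (metis image_eqI)
qed (use assms sposet_base.act_closed in fastforce)+

lemma orbit_lift:
  assumes e: "e \<in> sposet_hom T X Y" and k: "k \<in> sposet_hom T C Y"
    and x: "x \<in> carrier X" "e x = k c" and c: "c \<in> carrier C"
    and q: "\<And>d. d \<in> carrier C \<Longrightarrow> q d \<in> carrier T \<and> act C (q d) c = d"
  shows "compose (carrier C) e (\<lambda>d\<in>carrier C. act X (q d) x) = k"
proof (rule PiE_ext[OF _ sposet_hom_PiE[OF k]])
  have *: "e (act X (q d) x) = k d" if "d \<in> carrier C" for d
    using q[OF that] sposet_hom_act[OF e, of "q d" x] sposet_hom_act[OF k, of "q d" c] x c by simp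
  then show "compose (carrier C) e (\<lambda>d\<in>carrier C. act X (q d) x) \<in> carrier C \<rightarrow>\<^sub>E carrier Y"
    using sposet_hom_closed[OF k] by (simp add: compose_def)
  show "compose (carrier C) e (\<lambda>d\<in>carrier C. act X (q d) x) d = k d" if "d \<in> carrier C" for d
    using * that by (simp add: compose_eq)
qed

lemma right_cyclic_projectiveI:
  fixes T :: "'t pomonoid"
  assumes C: "right_sposet T C" and q: "q \<in> sposet_hom T C (right_regular T)"
    and c: "c \<in> carrier C" and qc: "\<And>x. x \<in> carrier C \<Longrightarrow> act C (q x) c = x"
  shows "right_cyclic_projective TYPE('x) TYPE('y) T C"
  unfolding right_cyclic_projective_def right_projective_def
proof (intro conjI C allI impI ballI)
  have q': "q x \<in> carrier T \<and> act C (q x) c = x" if "x \<in> carrier C" for x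
    using sposet_hom_closed[OF q that] qc[OF that] by (simp add: right_regular_def)
  show "cyclic_sposet T C"
    using right_sposet.axioms(1)[OF C] c q' by (rule cyclic_sposetI)
  fix X :: "('t, 'x) sposet" and Y :: "('t, 'y) sposet" and e k
  assume X: "right_sposet T X" and e: "sposet_epi T X Y e" and k: "k \<in> sposet_hom T C Y"
  obtain x where x: "x \<in> carrier X" "e x = k c"
    using e sposet_hom_closed[OF k c] by (metis sposet_epi_def imageE)
  show "\<exists>l\<in>sposet_hom T C X. compose (carrier C) e l = k"
  proof
    show "compose (carrier C) e (\<lambda>d\<in>carrier C. act X (q d) x) = k"
      using e k x c q' by (intro orbit_lift[where c = c]) (auto simp: sposet_epi_def)
  qed (rule right_orbit_hom[OF C X x(1) q])
qed

lemma left_cyclic_projectiveI: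
  fixes T :: "'t pomonoid"
  assumes C: "left_sposet T C" and q: "q \<in> sposet_hom T C (left_regular T)"
    and c: "c \<in> carrier C" and qc: "\<And>x. x \<in> carrier C \<Longrightarrow> act C (q x) c = x"
  shows "left_cyclic_projective TYPE('x) TYPE('y) T C"
  unfolding left_cyclic_projective_def left_projective_def
proof (intro conjI C allI impI ballI)
  have q': "q x \<in> carrier T \<and> act C (q x) c = x" if "x \<in> carrier C" for x
    using sposet_hom_closed[OF q that] qc[OF that] by (simp add: left_regular_def)
  show "cyclic_sposet T C"
    using left_sposet.axioms(1)[OF C] c q' by (rule cyclic_sposetI)
  fix X :: "('t, 'x) sposet" and Y :: "('t, 'y) sposet" and e k
  assume X: "left_sposet T X" and e: "sposet_epi T X Y e" and k: "k \<in> sposet_hom T C Y"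
  obtain x where x: "x \<in> carrier X" "e x = k c"
    using e sposet_hom_closed[OF k c] by (metis sposet_epi_def imageE)
  show "\<exists>l\<in>sposet_hom T C X. compose (carrier C) e l = k"
  proof
    show "compose (carrier C) e (\<lambda>d\<in>carrier C. act X (q d) x) = k"
      using e k x c q' by (intro orbit_lift[where c = c]) (auto simp: sposet_epi_def)
  qed (rule left_orbit_hom[OF C X x(1) q])
qed

lemma Emb_injective_over_section:
  fixes S :: "'s pomonoid" and B :: "('s, 'u) sposet"
  assumes B: "right_sposet S B" and f: "Emb_injective_over S A B f"
  obtains g where "g \<in> sposet_hom S B A" "compose (carrier B) f g = (\<lambda>x\<in>carrier B. x)"
proof -
  interpret B: right_sposet S B by fact
  define E :: "('s, 'u) sposet" where "E = \<lparr>carrier = {}, ord = {}, act = (\<lambda>_ x. x)\<rparr>"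
  have E: "right_sposet S E"
    by unfold_locales (auto simp: E_def order_on_defs refl_on_def)
  have hom_E: "(\<lambda>_. undefined) \<in> sposet_hom S E Z" for Z :: "('s, 'u) sposet"
    by (rule sposet_homI) (auto simp: E_def)
  have "sposet_embedding S E B (\<lambda>_. undefined)"
    using hom_E by (simp add: sposet_embedding_def E_def)
  moreover have "compose (carrier E) f (\<lambda>_. undefined)
      = compose (carrier E) (\<lambda>x\<in>carrier B. x) (\<lambda>_. undefined)"
    by (simp add: E_def compose_def restrict_def)
  ultimately have "\<exists>g\<in>sposet_hom S B A.
      compose (carrier E) g (\<lambda>_. undefined) = (\<lambda>_. undefined) \<and>
      compose (carrier B) f g = (\<lambda>x\<in>carrier B. x)"
    using f[unfolded Emb_injective_over_def, rule_format, of E B "\<lambda>_. undefined" "\<lambda>_. undefined"]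
      E B hom_E sposet_hom_id[OF B.sposet_base_axioms]
    by metis
  then show ?thesis
    using that by blast
qed

theorem theorem3p12:
  fixes S :: "'s pomonoid" and A B :: "('s, 'u) sposet" and f :: "'u \<Rightarrow> 'u"
  assumes universe: "infinite (UNIV :: 'u set)"
    and "pomonoid S"
    and "right_sposet S A" and "right_sposet S B"
    and "f \<in> sposet_hom S A B"
    and "Emb_injective_over S A B f"
  shows "right_generator TYPE('x) TYPE('y) (End_pomonoid S B) (hom_right S B A) \<and>
         left_generator TYPE('x) TYPE('y) (End_pomonoid S B) (hom_left S A B) \<and>
         left_cyclic_projective TYPE('x) TYPE('y) (End_pomonoid S A) (hom_left S B A) \<and>
         right_cyclic_projective TYPE('x) TYPE('y) (End_pomonoid S A) (hom_right S A B)"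
proof -
  obtain g where g: "g \<in> sposet_hom S B A" and fg: "compose (carrier B) f g = (\<lambda>x\<in>carrier B. x)"
    using Emb_injective_over_section assms(4,6) by blast
  note f = assms(5)
  interpret A: right_sposet S A by fact
  interpret B: right_sposet S B by fact
  note A = A.sposet_base_axioms and B = B.sposet_base_axioms
  have "right_generator TYPE('x) TYPE('y) (End_pomonoid S B) (hom_right S B A)"
    by (rule right_generatorI[OF right_sposet_hom_right[OF B A]
          hom_right_compose[OF B B f, folded regular_End], of g])
      (simp_all add: hom_right_def End_pomonoid_def g fg)
  moreover have "left_generator TYPE('x) TYPE('y) (End_pomonoid S B) (hom_left S A B)"
    by (rule left_generatorI[OF left_sposet_hom_left[OF A B]
          hom_left_compose[OF B A B g, folded regular_End], of f])
      (simp_all add: hom_left_def End_pomonoid_def f fg)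
  moreover have "left_cyclic_projective TYPE('x) TYPE('y) (End_pomonoid S A) (hom_left S B A)"
    by (rule left_cyclic_projectiveI[OF left_sposet_hom_left[OF B A]
          hom_left_compose[OF A B A f, folded regular_End], of g])
      (simp_all add: hom_left_def g fg sposet_hom_compose_id
        sposet_hom_compose_assoc[OF g, symmetric])
  moreover have "right_cyclic_projective TYPE('x) TYPE('y) (End_pomonoid S A) (hom_right S A B)"
    by (rule right_cyclic_projectiveI[OF right_sposet_hom_right[OF A B]
          hom_right_compose[OF A A g, folded regular_End], of f])
      (simp_all add: hom_right_def f fg sposet_hom_compose_id sposet_hom_compose_assoc)
  ultimately show ?thesis
    by blast
qed

end
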